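(* Let $A$ and $B$ be $n\times n$ Hermitian matrices. (1) If $\ker A\subseteq\ker B$, then $$n_-(A-B)=n_-(A)-n_-(B)+n_-\big(B^+-P_BA^+P_B\big).$$ (2) If $\ker B\subseteq\ker A$, then $$n_-(A-B)=n_-(A)-n_-(B)+n_-\big(P_AB^+P_A-A^+\big)+n_0(A)-n_0(B).$$
   Context: For a Hermitian matrix $X$: $n_-(X)$ is the number of negative eigenvalues of $X$ counted with multiplicity (Morse index), $n_0(X)=\dim\ker X$, $X^+$ is the Moore–Penrose pseudoinverse of $X$, and $P_X$ is the orthogonal projector onto $\operatorname{Ran}X$. *)

theory Defs
  imports
    "Jordan_Normal_Form.Schur_Decomposition"
    "Jordan_Normal_Form.Matrix_Kernel"
    "Jordan_Normal_Form.Char_Poly"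
begin

definition hermitian_mat :: "complex mat \<Rightarrow> bool" where
  "hermitian_mat X \<longleftrightarrow> mat_adjoint X = X"

text \<open>Morse index. The multiplicity of an eigenvalue is its algebraic multiplicity, i.e. its
  order as a root of the characteristic polynomial. All eigenvalues of a Hermitian matrix are
  real, so only real \<open>r\<close> are considered. The index set is finite for every square matrix.\<close>

definition n_minus :: "complex mat \<Rightarrow> nat" where
  "n_minus X = (\<Sum>r \<in> {r :: real. r < 0 \<and> eigenvalue X (complex_of_real r)}.
                   order (complex_of_real r) (char_poly X))"

definition n_zero :: "complex mat \<Rightarrow> nat" where
  "n_zero X = kernel_dim X"

text \<open>The four Penrose conditions.\<close>

definition is_pseudoinverse :: "complex mat \<Rightarrow> complex mat \<Rightarrow> bool" where
  "is_pseudoinverse X Y \<longleftrightarrow>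
     Y \<in> carrier_mat (dim_col X) (dim_row X) \<and>
     X * Y * X = X \<and> Y * X * Y = Y \<and>
     mat_adjoint (X * Y) = X * Y \<and> mat_adjoint (Y * X) = Y * X"

definition pseudoinverse :: "complex mat \<Rightarrow> complex mat" where
  "pseudoinverse X = (THE Y. is_pseudoinverse X Y)"

definition mat_range :: "complex mat \<Rightarrow> complex vec set" where
  "mat_range X = {X *\<^sub>v v | v. v \<in> carrier_vec (dim_col X)}"

definition is_range_projector :: "complex mat \<Rightarrow> complex mat \<Rightarrow> bool" where
  "is_range_projector X P \<longleftrightarrow>
     P \<in> carrier_mat (dim_row X) (dim_row X) \<and>
     P * P = P \<and> mat_adjoint P = P \<and> mat_range P = mat_range X"

definition range_projector :: "complex mat \<Rightarrow> complex mat" where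
  "range_projector X = (THE P. is_range_projector X P)"

end

theory Submission
  imports Defs
begin

text \<open>
  Part (1) compares two block diagonalizations of the Hermitian matrix with block rows \<open>(A, B)\<close>
  and \<open>(B, B)\<close>. Eliminating with the lower right block \<open>B\<close> leaves \<open>A - B\<close> and \<open>B\<close>; eliminating
  with \<open>A\<close>, which is possible because \<open>ker A \<subseteq> ker B\<close> means \<open>B = A A\<^sup>+ B\<close>, leaves \<open>A\<close> and
  \<open>B - B A\<^sup>+ B\<close>. By Sylvester's law of inertia both have the same Morse index, and
  \<open>B - B A\<^sup>+ B\<close> and \<open>B\<^sup>+ - P\<^sub>B A\<^sup>+ P\<^sub>B\<close> are congruent to each other through \<open>B\<close> and \<open>B\<^sup>+\<close>.
  Part (2) is part (1) for the pair \<open>(-B, -A)\<close>, combined with \<open>n\<^sub>-(X) + n\<^sub>-(-X) + n\<^sub>0(X) = n\<close>.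
\<close>

section \<open>Adjoints and diagonal matrices\<close>

lemma mat_adjoint_carrier [simp, intro]:
  "A \<in> carrier_mat m n \<Longrightarrow> mat_adjoint A \<in> carrier_mat n m"
  unfolding mat_adjoint_def by auto

lemma dim_mat_adjoint [simp]:
  "dim_row (mat_adjoint A) = dim_col A" "dim_col (mat_adjoint A) = dim_row A"
  unfolding mat_adjoint_def by auto

lemma index_mat_adjoint [simp]:
  fixes A :: "complex mat"
  assumes "i < dim_col A" "j < dim_row A"
  shows "mat_adjoint A $$ (i, j) = cnj (A $$ (j, i))"
  using assms unfolding mat_adjoint_def by (auto simp: mat_of_rows_def)

lemma mat_adjoint_adjoint [simp]:
  fixes A :: "complex mat"
  shows "mat_adjoint (mat_adjoint A) = A"
  by (rule eq_matI) auto

lemma mat_adjoint_one [simp]: "mat_adjoint (1\<^sub>m n :: complex mat) = 1\<^sub>m n"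
  by (rule eq_matI) auto

lemma mat_adjoint_zero [simp]: "mat_adjoint (0\<^sub>m m n :: complex mat) = 0\<^sub>m n m"
  by (rule eq_matI) auto

lemma mat_adjoint_uminus [simp]:
  fixes A :: "complex mat"
  shows "mat_adjoint (- A) = - mat_adjoint A"
  by (rule eq_matI) auto

lemma mat_adjoint_minus:
  fixes A :: "complex mat"
  assumes "A \<in> carrier_mat m n" "B \<in> carrier_mat m n"
  shows "mat_adjoint (A - B) = mat_adjoint A - mat_adjoint B"
  using assms by (intro eq_matI) auto

lemma mat_adjoint_mult:
  fixes A :: "complex mat"
  assumes "A \<in> carrier_mat m n" "B \<in> carrier_mat n k"
  shows "mat_adjoint (A * B) = mat_adjoint B * mat_adjoint A"
  using assms
  by (intro eq_matI) (auto simp: scalar_prod_def mult.commute)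

lemma mat_adjoint_four_block:
  fixes A :: "complex mat"
  assumes "A \<in> carrier_mat m n" "B \<in> carrier_mat m k" "C \<in> carrier_mat l n" "D \<in> carrier_mat l k"
  shows "mat_adjoint (four_block_mat A B C D) =
    four_block_mat (mat_adjoint A) (mat_adjoint C) (mat_adjoint B) (mat_adjoint D)"
  using assms by (intro eq_matI) auto

lemma scalar_prod_adjoint:
  fixes T :: "complex mat"
  assumes "T \<in> carrier_mat m k" "z \<in> carrier_vec m" "w \<in> carrier_vec k"
  shows "(mat_adjoint T *\<^sub>v z) \<bullet>c w = z \<bullet>c (T *\<^sub>v w)"
proof -
  have "(mat_adjoint T *\<^sub>v z) \<bullet>c w =
      (\<Sum>j = 0..<k. \<Sum>i = 0..<m. cnj (T $$ (i, j)) * z $ i * cnj (w $ j))"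
    using assms by (auto simp: scalar_prod_def sum_distrib_right intro!: sum.cong)
  also have "\<dots> = (\<Sum>i = 0..<m. \<Sum>j = 0..<k. cnj (T $$ (i, j)) * z $ i * cnj (w $ j))"
    by (rule sum.swap)
  also have "\<dots> = z \<bullet>c (T *\<^sub>v w)"
    using assms by (auto simp: scalar_prod_def sum_distrib_left mult_ac intro!: sum.cong)
  finally show ?thesis .
qed

text \<open>A list keeps repeated eigenvalues and their order. This allows induction on the entries,
  and later sorting, without treating multiplicities separately.\<close>

definition diag_of_list :: "complex list \<Rightarrow> complex mat" where
  "diag_of_list es = mat (length es) (length es) (\<lambda>(i, j). if i = j then es ! i else 0)"

lemma diag_of_list_carrier [simp]: "diag_of_list es \<in> carrier_mat (length es) (length es)"
  and dim_diag_of_list [simp]: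
    "dim_row (diag_of_list es) = length es" "dim_col (diag_of_list es) = length es"
  and index_diag_of_list [simp]:
    "i < length es \<Longrightarrow> j < length es \<Longrightarrow>
      diag_of_list es $$ (i, j) = (if i = j then es ! i else 0)"
  unfolding diag_of_list_def by auto

lemma diag_of_list_Cons:
  "diag_of_list (e # es) =
    four_block_mat (diag_of_list [e]) (0\<^sub>m 1 (length es)) (0\<^sub>m (length es) 1) (diag_of_list es)"
  by (rule eq_matI) (auto simp: nth_Cons split: nat.splits)

lemma diag_mat_diag_of_list [simp]: "diag_mat (diag_of_list es) = es"
  unfolding diag_mat_def by (auto intro!: nth_equalityI)

lemma upper_triangular_diag_of_list [simp]: "upper_triangular (diag_of_list es)"
  unfolding upper_triangular_def by auto

lemma char_poly_diag_of_list: "char_poly (diag_of_list es) = (\<Prod>e\<leftarrow>es. [:- e, 1:])"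
  using char_poly_upper_triangular[OF diag_of_list_carrier upper_triangular_diag_of_list, of es]
  by simp

lemma diag_of_list_mult_vec:
  assumes "v \<in> carrier_vec (length es)" "i < length es"
  shows "(diag_of_list es *\<^sub>v v) $ i = es ! i * v $ i"
proof -
  have "(diag_of_list es *\<^sub>v v) $ i = (\<Sum>j = 0..<length es. diag_of_list es $$ (i, j) * v $ j)"
    using assms by (simp add: scalar_prod_def)
  also have "\<dots> = (\<Sum>j = 0..<length es. if i = j then es ! i * v $ i else 0)"
    using assms by (intro sum.cong) auto
  finally show ?thesis using assms by simp
qed

lemma diag_of_list_mult:
  assumes "length ds = length es"
  shows "diag_of_list ds * diag_of_list es = diag_of_list (map2 (*) ds es)"
proof (rule eq_matI)
  fix i j assume ij: "i < dim_row (diag_of_list (map2 (*) ds es))"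
    "j < dim_col (diag_of_list (map2 (*) ds es))"
  have "(diag_of_list ds * diag_of_list es) $$ (i, j) =
      (\<Sum>l = 0..<length es. diag_of_list ds $$ (i, l) * diag_of_list es $$ (l, j))"
    using ij assms by (simp add: scalar_prod_def)
  also have "\<dots> =
      (\<Sum>l = 0..<length es. if i = l then (if i = j then ds ! i * es ! i else 0) else 0)"
    using ij assms by (intro sum.cong) auto
  finally show "(diag_of_list ds * diag_of_list es) $$ (i, j) = diag_of_list (map2 (*) ds es) $$ (i, j)"
    using ij assms by simp
qed (use assms in auto)

text \<open>Kernel dimensions add over a block diagonal, so the diagonal entries can be split off
  one at a time. A 1 by 1 block contributes 1 exactly when its entry is zero.\<close>

lemma kernel_dim_diag_of_list: "kernel_dim (diag_of_list es) = count_list es 0"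
proof (induction es)
  case Nil
  have "kernel.dim 0 (diag_of_list []) = 0"
    by (rule kernel_upper_triangular) (auto simp del: diag_mat_diag_of_list simp add: diag_mat_def)
  then show ?case by (simp add: kernel_dim_def)
next
  case (Cons e es)
  have one: "kernel.dim 1 (diag_of_list [e]) = (if e = 0 then 1 else 0)"
  proof (cases "e = 0")
    case True
    have c: "diag_of_list [e] \<in> carrier_mat 1 1" using diag_of_list_carrier[of "[e]"] by simp
    interpret kernel 1 1 "diag_of_list [e]" by (unfold_locales, rule c)
    have z: "diag_of_list [e] = 0\<^sub>m 1 1" using True by (intro eq_matI) auto
    \<comment> \<open>The pivot function is constantly 1, the number of columns, which is the
      convention for a zero row. With no nonzero row the kernel has dimension 1 - 0.\<close>
    have "row_echelon_form (diag_of_list [e])"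
      unfolding z row_echelon_form_def by (intro exI[of _ "\<lambda>_. 1"] pivot_funI) auto
    moreover have "{i. i < 1 \<and> row (diag_of_list [e]) i \<noteq> 0\<^sub>v 1} = {}"
      unfolding z by auto
    ultimately have "kernel.dim 1 (diag_of_list [e]) = 1 - card ({} :: nat set)"
      using find_base_vectors(6)[OF _ c] by metis
    then show ?thesis using True by simp
  next
    case False
    then show ?thesis
      using kernel_upper_triangular(1)[of "diag_of_list [e]" 1] diag_of_list_carrier[of "[e]"]
      by simp
  qed
  have "kernel.dim (1 + length es) (diag_of_list (e # es)) =
      kernel.dim 1 (diag_of_list [e]) + kernel.dim (length es) (diag_of_list es)"
    by (rule kernel_four_block_0_mat[OF diag_of_list_Cons])
      (use diag_of_list_carrier[of "[e]"] in auto)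
  with one Cons show ?case by (simp add: kernel_dim_def)
qed

section \<open>Unitary diagonalization\<close>

text \<open>Complete \<open>v\<close> to a basis with \<open>v\<close> in front and orthogonalize.
  Gram-Schmidt leaves the first vector unchanged, and normalizing the columns only rescales it,
  which is the source of the factor \<open>c\<close>.\<close>

lemma unitary_with_given_first_column:
  fixes v :: "complex vec"
  assumes v: "v \<in> carrier_vec n" "v \<noteq> 0\<^sub>v n"
  obtains U c where "U \<in> carrier_mat n n" "mat_adjoint U * U = 1\<^sub>m n" "U * mat_adjoint U = 1\<^sub>m n"
    "col U 0 = c \<cdot>\<^sub>v v"
proof -
  interpret cof_vec_space n "TYPE(complex)" .
  have n: "n > 0" using v by (cases n) auto
  define b where "b = basis_completion v"
  note bc = basis_completion[OF v, folded b_def]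
  define ws where "ws = gram_schmidt n b"
  have ws: "corthogonal ws" "set ws \<subseteq> carrier_vec n" "length ws = n"
    using gram_schmidt_result[OF bc(2) bc(4) bc(5) ws_def] bc(6) by auto
  have hdws: "ws ! 0 = v"
  proof -
    obtain bs where "b = v # bs" using bc(6,7) n by (cases b) auto
    then have "hd ws = v" unfolding ws_def using gram_schmidt_hd[OF v(1)] by simp
    then show ?thesis using ws(3) n by (cases ws) auto
  qed
  have wc: "ws ! i \<in> carrier_vec n" if "i < n" for i using ws that by auto
  \<comment> \<open>\<open>s i\<close> is the Euclidean norm of the vector at index
    \<open>i\<close>. Taking \<open>Re\<close> loses nothing, since \<open>nn\<close> shows that the
    inner product is a nonnegative real.\<close>
  define s where "s i = sqrt (Re (ws ! i \<bullet>c ws ! i))" for i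
  have nn: "ws ! i \<bullet>c ws ! i = complex_of_real (\<Sum>k = 0..<n. (cmod (ws ! i $ k))\<^sup>2)" if "i < n" for i
    using wc[OF that] by (auto simp: scalar_prod_def complex_norm_square simp del: of_real_power intro!: sum.cong)
  have ss: "complex_of_real (s i) * complex_of_real (s i) = ws ! i \<bullet>c ws ! i" if "i < n" for i
    unfolding s_def nn[OF that] by (simp flip: of_real_mult add: sum_nonneg)
  have s0: "s i \<noteq> 0" if "i < n" for i
    using ss[OF that] corthogonalD[OF ws(1), of i i] that ws(3) by auto
  define U where "U = mat n n (\<lambda>(i, j). ws ! j $ i / complex_of_real (s j))"
  have U: "U \<in> carrier_mat n n" unfolding U_def by simp
  have UU: "mat_adjoint U * U = 1\<^sub>m n"
  proof (rule eq_matI)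
    fix i j assume "i < dim_row (1\<^sub>m n :: complex mat)" "j < dim_col (1\<^sub>m n :: complex mat)"
    then have ij: "i < n" "j < n" by auto
    have "(mat_adjoint U * U) $$ (i, j) =
        (\<Sum>k = 0..<n. cnj (ws ! i $ k / complex_of_real (s i)) * (ws ! j $ k / complex_of_real (s j)))"
      using ij by (simp add: U_def scalar_prod_def)
    also have "\<dots> = (ws ! j \<bullet>c ws ! i) / (complex_of_real (s i) * complex_of_real (s j))"
      using ij wc[OF ij(1)] wc[OF ij(2)]
      by (auto simp: scalar_prod_def sum_divide_distrib mult.commute intro!: sum.cong)
    also have "\<dots> = 1\<^sub>m n $$ (i, j)"
    proof (cases "i = j")
      case True
      then show ?thesis using ij ss[OF ij(1)] s0[OF ij(1)] by (simp flip: ss)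
    next
      case False
      then show ?thesis using ij corthogonalD[OF ws(1), of j i] ws(3) by simp
    qed
    finally show "(mat_adjoint U * U) $$ (i, j) = 1\<^sub>m n $$ (i, j)" .
  qed (use U in auto)
  have "U * mat_adjoint U = 1\<^sub>m n"
    using mat_mult_left_right_inverse[OF _ U UU] U by simp
  moreover have "col U 0 = (1 / complex_of_real (s 0)) \<cdot>\<^sub>v v"
    using n v unfolding U_def by (intro eq_vecI) (auto simp: hdws)
  ultimately show ?thesis using that U UU by blast
qed

text \<open>The entries may be any complex numbers, and the list also fixes the dimension. Keeping
  \<open>U\<close> fixed while the list varies gives a calculus of simultaneously diagonalized
  matrices, from which the pseudoinverse is built.\<close>

definition diagonalizes :: "complex mat \<Rightarrow> complex list \<Rightarrow> complex mat \<Rightarrow> bool" where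
  "diagonalizes U es A \<longleftrightarrow> U \<in> carrier_mat (length es) (length es) \<and>
     mat_adjoint U * U = 1\<^sub>m (length es) \<and> U * mat_adjoint U = 1\<^sub>m (length es) \<and>
     A = U * diag_of_list es * mat_adjoint U"

lemma char_poly_four_block_diag:
  fixes A D :: "complex mat"
  assumes "A \<in> carrier_mat n n" "D \<in> carrier_mat m m"
  shows "char_poly (four_block_mat A (0\<^sub>m n m) (0\<^sub>m m n) D) = char_poly A * char_poly D"
  using char_poly_0_block[OF refl _ _ assms(1) zero_carrier_mat assms(2)]
    char_poly_factorized[OF assms(1)] char_poly_factorized[OF assms(2)] by blast

lemma adjoint_congruence_hermitian:
  assumes "X \<in> carrier_mat m m" "hermitian_mat X" "S \<in> carrier_mat m k"
  shows "hermitian_mat (mat_adjoint S * X * S)"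
proof -
  have "mat_adjoint (mat_adjoint S * X * S) = mat_adjoint S * (mat_adjoint X * S)"
    using assms mat_adjoint_mult[of "mat_adjoint S * X" k m S k] mat_adjoint_mult[of "mat_adjoint S" k m X m]
    by (simp add: mult_carrier_mat[of _ k m _ m])
  then show ?thesis
    using assms unfolding hermitian_mat_def by (simp add: assoc_mult_mat[of _ k m _ m _ k])
qed

text \<open>Spectral theorem by deflation: a unitary matrix whose first column is an eigenvector for
  \<open>e\<close> splits off a 1 by 1 block, and the Hermitian remainder has the remaining roots.
  Any ordering of the roots is accepted, so a sorted one can be chosen afterwards.\<close>

lemma hermitian_diagonalizes:
  assumes "A \<in> carrier_mat n n" "hermitian_mat A" "char_poly A = (\<Prod>e\<leftarrow>es. [:- e, 1:])"
  shows "length es = n \<and> (\<forall>e \<in> set es. e \<in> \<real>) \<and> (\<exists>U. diagonalizes U es A)"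
  using assms
proof (induction es arbitrary: A n)
  case Nil
  have n: "n = 0" using degree_monic_char_poly[OF Nil(1)] Nil(3) by simp
  have "A = 1\<^sub>m 0 * diag_of_list [] * mat_adjoint (1\<^sub>m 0)"
    using Nil n by (intro eq_matI) auto
  then have "diagonalizes (1\<^sub>m 0) [] A" unfolding diagonalizes_def by simp
  then show ?case using n by auto
next
  case (Cons e es)
  note A = Cons.prems(1)
  have "eigenvalue A e"
    unfolding eigenvalue_root_char_poly[OF A] Cons.prems by simp
  then obtain v where v: "v \<in> carrier_vec n" "v \<noteq> 0\<^sub>v n" "A *\<^sub>v v = e \<cdot>\<^sub>v v"
    using A unfolding eigenvalue_def eigenvector_def by auto
  obtain U c where U: "U \<in> carrier_mat n n" and UU: "mat_adjoint U * U = 1\<^sub>m n"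
    and UU': "U * mat_adjoint U = 1\<^sub>m n" and col: "col U 0 = c \<cdot>\<^sub>v v"
    using unitary_with_given_first_column[OF v(1,2)] by blast
  define U' where "U' = mat_adjoint U"
  have U': "U' \<in> carrier_mat n n" using U unfolding U'_def by simp
  note [simp] = assoc_mult_mat[of _ n n _ n _ n] mult_carrier_mat[of _ n n _ n]
    left_mult_one_mat[of _ n n] right_mult_one_mat[of _ n n] U U' A
  obtain m where n: "n = Suc m" using v by (cases n) auto
  define H where "H = U' * A * U"
  have H: "H \<in> carrier_mat n n" unfolding H_def by simp
  have hH: "mat_adjoint H = H"
    using adjoint_congruence_hermitian[OF A Cons.prems(2) U]
    unfolding H_def U'_def hermitian_mat_def .
  have "A *\<^sub>v col U 0 = e \<cdot>\<^sub>v col U 0"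
    unfolding col using v A by (simp add: mult_mat_vec[OF A v(1)] smult_smult_assoc mult.commute)
  then have colAU: "col (A * U) 0 = e \<cdot>\<^sub>v col U 0"
    using col_mult2[OF A U, of 0] n by simp
  \<comment> \<open>The first column of \<open>U\<close> is an eigenvector and the columns of
    \<open>U\<close> are orthonormal, so the first column of \<open>H\<close> is \<open>e\<close>
    times the first unit vector.\<close>
  have H0: "H $$ (i, 0) = (if i = 0 then e else 0)" if "i < n" for i
  proof -
    have "H $$ (i, 0) = row U' i \<bullet> col (A * U) 0"
      unfolding H_def using that n A U U' by (simp del: col_mult2)
    also have "\<dots> = e * (row U' i \<bullet> col U 0)"
      unfolding colAU using row_carrier_vec[OF that U'] col_carrier_vec[OF _ U, of 0] n
      by (intro scalar_prod_smult_distrib[of _ n]) blast+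
    also have "row U' i \<bullet> col U 0 = (U' * U) $$ (i, 0)"
      using that n U U' by simp
    finally show ?thesis using that n UU unfolding U'_def by simp
  qed
  \<comment> \<open>Hermitian symmetry reflects the first column into the first row. The corner
    entry shows that \<open>e\<close> equals its own conjugate.\<close>
  have H0': "H $$ (0, i) = (if i = 0 then e else 0)" if "i < n" for i
  proof -
    have "H $$ (0, i) = cnj (H $$ (i, 0))"
      using arg_cong[OF hH, of "\<lambda>M. M $$ (0, i)"] H that n by simp
    moreover have "cnj e = e"
      using arg_cong[OF hH, of "\<lambda>M. M $$ (0, 0)"] H H0[of 0] n by simp
    ultimately show ?thesis using H0[OF that] by simp
  qed
  have e: "e \<in> \<real>"
    using arg_cong[OF hH, of "\<lambda>M. M $$ (0, 0)"] H H0[of 0] n by (simp add: Reals_cnj_iff)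
  define K where "K = mat m m (\<lambda>(i, j). H $$ (Suc i, Suc j))"
  have K: "K \<in> carrier_mat m m" unfolding K_def by simp
  have hK: "hermitian_mat K"
    unfolding hermitian_mat_def
  proof (rule eq_matI)
    fix i j assume "i < dim_row K" "j < dim_col K"
    then show "mat_adjoint K $$ (i, j) = K $$ (i, j)"
      using arg_cong[OF hH, of "\<lambda>M. M $$ (Suc i, Suc j)"] H n unfolding K_def by simp
  qed (auto simp: K_def)
  have d1: "diag_of_list [e] \<in> carrier_mat 1 1" using diag_of_list_carrier[of "[e]"] by simp
  have HK: "H = four_block_mat (diag_of_list [e]) (0\<^sub>m 1 m) (0\<^sub>m m 1) K"
    using H n H0 H0' by (intro eq_matI) (auto simp: K_def)
  have AH: "A = U * H * U'"
  proof -
    have "U * H * U' = (U * U') * A * (U * U')" unfolding H_def by simp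
    then show ?thesis using UU' unfolding U'_def by simp
  qed
  have "similar_mat_wit A H U U'"
    by (rule similar_mat_witI[of _ _ n]) (use AH UU UU' H in \<open>auto simp: U'_def\<close>)
  then have "char_poly A = char_poly H"
    using char_poly_similar unfolding similar_mat_def by blast
  \<comment> \<open>Cancelling the linear factor of \<open>e\<close> leaves the factorization of
    \<open>char_poly K\<close> required by the induction hypothesis.\<close>
  then have "[:- e, 1:] * char_poly K = [:- e, 1:] * (\<Prod>e\<leftarrow>es. [:- e, 1:])"
    unfolding HK char_poly_four_block_diag[OF d1 K] char_poly_diag_of_list Cons.prems by simp
  then have "char_poly K = (\<Prod>e\<leftarrow>es. [:- e, 1:])"
    by (metis mult_cancel_left pCons_eq_0_iff zero_neq_one)
  from Cons.IH[OF K hK this] obtain V where len: "length es = m" and re: "\<forall>e \<in> set es. e \<in> \<real>"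
    and "diagonalizes V es K" by auto
  then have V: "V \<in> carrier_mat m m" and VV: "mat_adjoint V * V = 1\<^sub>m m"
    and VV': "V * mat_adjoint V = 1\<^sub>m m" and KV: "K = V * diag_of_list es * mat_adjoint V"
    unfolding diagonalizes_def by auto
  \<comment> \<open>\<open>W\<close> is the identity on the first coordinate and diagonalizes the
    trailing block of \<open>H\<close>, so \<open>U * W\<close> diagonalizes
    \<open>A\<close>.\<close>
  define W where "W = four_block_mat (1\<^sub>m 1) (0\<^sub>m 1 m) (0\<^sub>m m 1) V"
  define W' where "W' = four_block_mat (1\<^sub>m 1) (0\<^sub>m 1 m) (0\<^sub>m m 1) (mat_adjoint V)"
  have W: "W \<in> carrier_mat n n" "W' \<in> carrier_mat n n"
    unfolding W_def W'_def n using V by auto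
  have aW: "mat_adjoint W = W'"
    unfolding W_def W'_def using V by (subst mat_adjoint_four_block) auto
  have dl: "diag_of_list es \<in> carrier_mat m m" using len by auto
  have W1: "W' * W = 1\<^sub>m n"
    unfolding W_def W'_def n using V VV
    by (subst mult_four_block_mat[of _ 1 1 _ m _ m _ _ 1 _ m]) auto
  have W2: "W * W' = 1\<^sub>m n"
    unfolding W_def W'_def n using V VV'
    by (subst mult_four_block_mat[of _ 1 1 _ m _ m _ _ 1 _ m]) auto
  define D where "D = diag_of_list (e # es)"
  have D: "D \<in> carrier_mat n n" unfolding D_def n len[symmetric] using diag_of_list_carrier[of "e # es"] by simp
  have "W * D = four_block_mat (diag_of_list [e]) (0\<^sub>m 1 m) (0\<^sub>m m 1) (V * diag_of_list es)"
    unfolding W_def D_def diag_of_list_Cons[of e es] len using V dl d1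
    by (subst mult_four_block_mat[of _ 1 1 _ m _ m _ _ 1 _ m]) auto
  then have "W * D * W' = H"
    unfolding HK W'_def using V dl d1
    by (simp add: KV, subst mult_four_block_mat[of _ 1 1 _ m _ m _ _ 1 _ m]) auto
  then have "A = U * (W * D * W') * U'" using AH by simp
  then have "A = (U * W) * D * (W' * U')" using W D by simp
  moreover have a: "mat_adjoint (U * W) = W' * U'"
    using mat_adjoint_mult[OF U W(1)] aW unfolding U'_def by simp
  moreover have "W' * U' * (U * W) = 1\<^sub>m n"
  proof -
    have "W' * U' * (U * W) = W' * ((U' * U) * W)" using W by simp
    also have "\<dots> = 1\<^sub>m n" unfolding UU[folded U'_def] using W W1 by simp
    finally show ?thesis .
  qed
  moreover have "(U * W) * (W' * U') = 1\<^sub>m n"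
  proof -
    have "(U * W) * (W' * U') = U * ((W * W') * U')" using W by simp
    also have "\<dots> = 1\<^sub>m n" unfolding W2 using UU' unfolding U'_def by simp
    finally show ?thesis .
  qed
  moreover have "U * W \<in> carrier_mat n n" using W by simp
  moreover have "length (e # es) = n" using len n by simp
  ultimately have "diagonalizes (U * W) (e # es) A"
    unfolding diagonalizes_def D_def by metis
  then show ?case using re e len n by auto
qed

section \<open>Inertia of Hermitian matrices\<close>

text \<open>A factorization into linear factors determines the roots only up to permutation, and
  here all roots are real. Their real parts can therefore be sorted and fed back into
  \<open>hermitian_diagonalizes\<close>.\<close>

lemma hermitian_diagonalizes_sorted:
  assumes A: "A \<in> carrier_mat n n" "hermitian_mat A"
  obtains U rs where "length rs = n" "sorted rs" "diagonalizes U (map complex_of_real rs) A"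
proof -
  obtain es where es: "char_poly A = (\<Prod>e\<leftarrow>es. [:- e, 1:])"
    using char_poly_factorized[OF A(1)] by blast
  have re: "\<forall>e \<in> set es. e \<in> \<real>" and len: "length es = n"
    using hermitian_diagonalizes[OF A es] by auto
  define rs where "rs = sort (map Re es)"
  have "mset (map complex_of_real rs) = image_mset (complex_of_real \<circ> Re) (mset es)"
    unfolding rs_def by (simp add: image_mset.compositionality)
  also have "\<dots> = image_mset id (mset es)"
    using re by (intro image_mset_cong) auto
  finally have "mset (map complex_of_real rs) = mset es" by simp
  then have "mset (map (\<lambda>e. [:- e, 1:]) (map complex_of_real rs)) = mset (map (\<lambda>e. [:- e, 1:]) es)"
    by (metis mset_map)
  then have "char_poly A = (\<Prod>e\<leftarrow>map complex_of_real rs. [:- e, 1:])"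
    unfolding es by (metis prod_mset_prod_list)
  from hermitian_diagonalizes[OF A this] obtain U where "diagonalizes U (map complex_of_real rs) A"
    by blast
  then show ?thesis using that[of rs U] len unfolding rs_def by simp
qed

lemma diagonalizes_similar: "diagonalizes U es A \<Longrightarrow> similar_mat_wit A (diag_of_list es) U (mat_adjoint U)"
  by (rule similar_mat_witI[of _ _ "length es"])
    (auto simp: diagonalizes_def intro!: mult_carrier_mat[of _ _ "length es"])

lemma diagonalizes_uminus:
  assumes "diagonalizes U es A"
  shows "diagonalizes U (map uminus es) (- A)"
proof -
  let ?n = "length es"
  have U: "U \<in> carrier_mat ?n ?n" using assms unfolding diagonalizes_def by simp
  have "diag_of_list (map uminus es) = - diag_of_list es"
    by (rule eq_matI) auto
  then have "U * diag_of_list (map uminus es) * mat_adjoint U = - (U * diag_of_list es * mat_adjoint U)"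
    using U uminus_mult_right_mat[of U "diag_of_list es"]
      uminus_mult_left_mat[of "U * diag_of_list es" "mat_adjoint U"] by simp
  then show ?thesis using assms unfolding diagonalizes_def by simp
qed

lemma order_prod_list_linear_factors:
  fixes es :: "'a :: idom list"
  shows "order x (\<Prod>e\<leftarrow>es. [:- e, 1:]) = count_list es x"
proof (induction es)
  case (Cons e es)
  have "(\<Prod>e\<leftarrow>es. [:- e, 1:]) \<noteq> 0"
    by (induction es) (auto simp del: mult_pCons_left)
  then have "order x ([:- e, 1:] * (\<Prod>e\<leftarrow>es. [:- e, 1:])) =
      order x [:- e, 1:] + order x (\<Prod>e\<leftarrow>es. [:- e, 1:])"
    by (intro order_mult) (simp del: mult_pCons_left)
  then show ?case using Cons by (simp add: order_linear' del: mult_pCons_left)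
qed simp

text \<open>Similar matrices share the characteristic polynomial, so the order of a root is its
  number of occurrences in \<open>rs\<close>. Adding these counts over the distinct negative entries
  gives the number of negative positions.\<close>

lemma n_minus_diagonalizes:
  assumes "diagonalizes U (map complex_of_real rs) A"
  shows "n_minus A = length (filter (\<lambda>r. r < 0) rs)"
proof -
  let ?cs = "map complex_of_real rs"
  have A: "A \<in> carrier_mat (length rs) (length rs)"
    using similar_mat_witD[OF refl diagonalizes_similar[OF assms]] 
    by (metis diag_of_list_carrier carrier_matI carrier_matD length_map)
  have cp: "char_poly A = (\<Prod>e\<leftarrow>?cs. [:- e, 1:])"
    using diagonalizes_similar[OF assms] char_poly_similar char_poly_diag_of_list
    unfolding similar_mat_def by metis
  have order: "order (complex_of_real r) (char_poly A) = count_list rs r" for r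
    unfolding cp order_prod_list_linear_factors by (induction rs) auto
  have "eigenvalue A (complex_of_real r) \<longleftrightarrow> r \<in> set rs" for r
    unfolding eigenvalue_root_char_poly[OF A] cp poly_prod_list_zero_iff by auto
  then have "n_minus A = (\<Sum>r \<in> {r. r < 0 \<and> r \<in> set rs}. count_list rs r)"
    unfolding n_minus_def order by simp
  also have "\<dots> = (\<Sum>r \<in> set (filter (\<lambda>r. r < 0) rs). count_list (filter (\<lambda>r. r < 0) rs) r)"
  proof (rule sum.cong)
    fix r assume "r \<in> set (filter (\<lambda>r. r < 0) rs)"
    then have "r < 0" by simp
    then show "count_list rs r = count_list (filter (\<lambda>r. r < 0) rs) r" by (induction rs) auto
  qed auto
  also have "\<dots> = length (filter (\<lambda>r. r < 0) rs)"
    by (rule sum_count_set) auto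
  finally show ?thesis .
qed

lemma n_zero_diagonalizes:
  assumes "diagonalizes U es A"
  shows "n_zero A = count_list es 0"
proof -
  have sim: "similar_mat_wit A (diag_of_list es) U (mat_adjoint U)"
    by (rule diagonalizes_similar[OF assms])
  have A: "A \<in> carrier_mat (length es) (length es)"
    using similar_mat_witD[OF refl sim] by (metis diag_of_list_carrier carrier_matI carrier_matD)
  from similar_mat_wit_kernel_dim[OF A sim] show ?thesis
    using A unfolding n_zero_def kernel_dim_diag_of_list[symmetric] kernel_dim_def by simp
qed

text \<open>Negating the eigenvalue list diagonalizes \<open>- A\<close> with the same unitary
  matrix. The three numbers thus count the negative, positive and zero entries of one list of length
  \<open>n\<close>.\<close>

lemma n_minus_add_n_plus_add_n_zero:
  assumes "A \<in> carrier_mat n n" "hermitian_mat A"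
  shows "n_minus A + n_minus (- A) + n_zero A = n"
proof -
  obtain U rs where rs: "length rs = n" and d: "diagonalizes U (map complex_of_real rs) A"
    using hermitian_diagonalizes_sorted[OF assms] by blast
  have "diagonalizes U (map complex_of_real (map uminus rs)) (- A)"
    using diagonalizes_uminus[OF d] by (simp add: comp_def)
  then have "n_minus (- A) = length (filter (\<lambda>r. r < 0) (map uminus rs))"
    by (rule n_minus_diagonalizes)
  moreover have "n_minus A = length (filter (\<lambda>r. r < 0) rs)"
    by (rule n_minus_diagonalizes[OF d])
  moreover have "n_zero A = count_list (map complex_of_real rs) 0"
    by (rule n_zero_diagonalizes[OF d])
  moreover have "length (filter (\<lambda>r. r < 0) rs) + length (filter (\<lambda>r. r < 0) (map uminus rs)) +
      count_list (map complex_of_real rs) 0 = length rs"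
    by (induction rs) auto
  ultimately show ?thesis using rs by simp
qed

section \<open>Sylvester's law of inertia\<close>

lemma sorted_nth_less_iff:
  fixes xs :: "'a :: linorder list"
  assumes "sorted xs" "i < length xs"
  shows "xs ! i < a \<longleftrightarrow> i < length (filter (\<lambda>x. x < a) xs)"
  using assms
proof (induction xs arbitrary: i)
  case (Cons x xs)
  show ?case
  proof (cases "x < a")
    case True
    then show ?thesis using Cons by (cases i) auto
  next
    case False
    then have ge: "\<not> y < a" if "y \<in> set (x # xs)" for y
      using Cons.prems(1) that by auto
    then have "filter (\<lambda>x. x < a) (x # xs) = []" by (simp add: filter_empty_conv)
    moreover have "\<not> (x # xs) ! i < a" using ge nth_mem[OF Cons.prems(2)] by blast
    ultimately show ?thesis by (simp only: list.size less_nat_zero_code)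
  qed
qed simp

text \<open>The \<open>q\<close> equations are padded with zero rows to a square system with
  \<open>p\<close> unknowns. Since \<open>q < p\<close>, row \<open>q\<close> is a zero row and the
  determinant vanishes.\<close>

lemma underdetermined_system:
  fixes T :: "complex mat"
  assumes "q < p"
  obtains v where "v \<in> carrier_vec p" "v \<noteq> 0\<^sub>v p" "\<And>i. i < q \<Longrightarrow> (\<Sum>j = 0..<p. T $$ (i, j) * v $ j) = 0"
proof -
  define c where "c i = (if i < q then vec p (\<lambda>j. T $$ (i, j)) else 0\<^sub>v p)" for i
  \<comment> \<open>The row function \<open>c\<close> is already zero at \<open>q\<close>. The case
    distinction gives \<open>M\<close> the syntactic form of \<open>det_row_0\<close>.\<close>
  define M where "M = mat\<^sub>r p p (\<lambda>i. if i = q then 0\<^sub>v p else c i)"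
  have M: "M \<in> carrier_mat p p" unfolding M_def by simp
  have "det M = 0"
    unfolding M_def by (rule det_row_0[OF assms]) (auto simp: c_def)
  then obtain v where v: "v \<in> carrier_vec p" "v \<noteq> 0\<^sub>v p" "M *\<^sub>v v = 0\<^sub>v p"
    using det_0_iff_vec_prod_zero_field[OF M] by blast
  have "(\<Sum>j = 0..<p. T $$ (i, j) * v $ j) = 0" if "i < q" for i
  proof -
    have "(M *\<^sub>v v) $ i = (\<Sum>j = 0..<p. T $$ (i, j) * v $ j)"
      using that assms v(1) by (simp add: M_def c_def scalar_prod_def)
    then show ?thesis using v(3) that assms by simp
  qed
  then show ?thesis using that v by blast
qed

lemma diag_of_list_quadratic_form:
  assumes "v \<in> carrier_vec (length rs)"
  shows "(diag_of_list (map complex_of_real rs) *\<^sub>v v) \<bullet>c v =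
    complex_of_real (\<Sum>i = 0..<length rs. rs ! i * (cmod (v $ i))\<^sup>2)"
proof -
  have "(diag_of_list (map complex_of_real rs) *\<^sub>v v) \<bullet>c v =
      (\<Sum>i = 0..<length rs. (diag_of_list (map complex_of_real rs) *\<^sub>v v) $ i * cnj (v $ i))"
    using assms by (auto simp: scalar_prod_def simp del: index_mult_mat_vec)
  also have "\<dots> = (\<Sum>i = 0..<length rs. complex_of_real (rs ! i * (cmod (v $ i))\<^sup>2))"
    using assms
    by (intro sum.cong)
      (auto simp: diag_of_list_mult_vec complex_norm_square simp del: of_real_power index_mult_mat_vec)
  finally show ?thesis by simp
qed

text \<open>If \<open>es\<close> had more negative entries than \<open>ds\<close>, some nonzero \<open>w\<close> supported on the negative
  positions of \<open>es\<close> would be mapped by \<open>T\<close> into the span of the nonnegative positions of \<open>ds\<close>.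
  Sortedness makes these positions initial and final segments.\<close>

lemma sylvester_diag_le:
  assumes "sorted ds" "sorted es" and T: "T \<in> carrier_mat (length ds) (length es)"
    and eq: "diag_of_list (map complex_of_real es) =
      mat_adjoint T * diag_of_list (map complex_of_real ds) * T"
  shows "length (filter (\<lambda>r. r < 0) es) \<le> length (filter (\<lambda>r. r < 0) ds)"
proof (rule ccontr)
  let ?m = "length ds" and ?k = "length es"
  let ?D = "diag_of_list (map complex_of_real ds)" and ?E = "diag_of_list (map complex_of_real es)"
  define p where "p = length (filter (\<lambda>r. r < 0) es)"
  define q where "q = length (filter (\<lambda>r. r < 0) ds)"
  assume "\<not> length (filter (\<lambda>r. r < 0) es) \<le> length (filter (\<lambda>r. r < 0) ds)"
  then have "q < p" unfolding p_def q_def by simp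
  have p: "p \<le> ?k" unfolding p_def by simp
  have q: "q \<le> ?m" unfolding q_def by simp
  obtain v where v: "v \<in> carrier_vec p" "v \<noteq> 0\<^sub>v p"
    and Tv: "\<And>i. i < q \<Longrightarrow> (\<Sum>j = 0..<p. T $$ (i, j) * v $ j) = 0"
    using underdetermined_system[OF \<open>q < p\<close>] by blast
  define w where "w = vec ?k (\<lambda>j. if j < p then v $ j else 0)"
  have w: "w \<in> carrier_vec ?k" unfolding w_def by simp
  define y where "y = T *\<^sub>v w"
  have y: "y \<in> carrier_vec ?m" unfolding y_def using T w by simp
  have D: "?D \<in> carrier_mat ?m ?m" using diag_of_list_carrier[of "map complex_of_real ds"] by simp
  \<comment> \<open>The choice of \<open>v\<close> makes \<open>y\<close> vanish at the negative
    positions of \<open>ds\<close>, which are the first \<open>q\<close>.\<close>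
  have y0: "y $ i = 0" if "i < q" for i
  proof -
    have "y $ i = (\<Sum>j = 0..<?k. T $$ (i, j) * (if j < p then v $ j else 0))"
      unfolding y_def w_def using T that q by (simp add: scalar_prod_def)
    also have "\<dots> = (\<Sum>j = 0..<p. T $$ (i, j) * v $ j)"
      using p by (intro sum.mono_neutral_cong_right) auto
    finally show ?thesis using Tv[OF that] by simp
  qed
  have "?E *\<^sub>v w = mat_adjoint T *\<^sub>v (?D *\<^sub>v y)"
    unfolding eq y_def using T D w
    by (simp add: assoc_mult_mat_vec[of _ ?k ?m _ ?k] assoc_mult_mat_vec[of _ ?k ?m _ ?m]
      assoc_mult_mat_vec[of _ ?m ?m _ ?k] mult_carrier_mat[of _ ?k ?m _ ?m])
  then have "(?E *\<^sub>v w) \<bullet>c w = (?D *\<^sub>v y) \<bullet>c y"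
    using scalar_prod_adjoint[OF T _ w, of "?D *\<^sub>v y"] D y unfolding y_def by simp
  then have eq: "(\<Sum>j = 0..<?k. es ! j * (cmod (w $ j))\<^sup>2) = (\<Sum>i = 0..<?m. ds ! i * (cmod (y $ i))\<^sup>2)"
    unfolding diag_of_list_quadratic_form[OF w] diag_of_list_quadratic_form[OF y] of_real_eq_iff .
  \<comment> \<open>Below \<open>q\<close> the vector \<open>y\<close> vanishes; from
    \<open>q\<close> on the entries of \<open>ds\<close> are nonnegative by sortedness.\<close>
  have "0 \<le> (\<Sum>i = 0..<?m. ds ! i * (cmod (y $ i))\<^sup>2)"
  proof (rule sum_nonneg)
    fix i assume "i \<in> {0..<?m}"
    then show "0 \<le> ds ! i * (cmod (y $ i))\<^sup>2"
      using y0[of i] sorted_nth_less_iff[OF assms(1), of i 0] unfolding q_def by (cases "ds ! i < 0") auto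
  qed
  \<comment> \<open>\<open>es\<close> is negative on the support of \<open>w\<close>, and a nonzero
    coordinate of \<open>v\<close> makes the inequality strict.\<close>
  moreover have "(\<Sum>j = 0..<?k. es ! j * (cmod (w $ j))\<^sup>2) < (\<Sum>j = 0..<?k. 0)"
  proof (rule sum_strict_mono_ex1)
    show "\<forall>j \<in> {0..<?k}. es ! j * (cmod (w $ j))\<^sup>2 \<le> 0"
    proof
      fix j assume j: "j \<in> {0..<?k}"
      show "es ! j * (cmod (w $ j))\<^sup>2 \<le> 0"
      proof (cases "j < p")
        case True
        then have "es ! j < 0" using sorted_nth_less_iff[OF assms(2), of j 0] j unfolding p_def by simp
        then show ?thesis by (simp add: mult_nonpos_nonneg)
      qed (use j in \<open>simp add: w_def\<close>)
    qed
    obtain j where j: "j < p" "v $ j \<noteq> 0"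
      using v by (metis eq_vecI carrier_vecD index_zero_vec)
    then have "es ! j < 0" using sorted_nth_less_iff[OF assms(2), of j 0] p unfolding p_def by simp
    then have "es ! j * (cmod (w $ j))\<^sup>2 < 0"
      using j p unfolding w_def by (simp add: mult_neg_pos)
    then show "\<exists>j \<in> {0..<?k}. es ! j * (cmod (w $ j))\<^sup>2 < 0"
      using j p by (intro bexI[of _ j]) auto
  qed simp
  ultimately show False using eq by simp
qed

text \<open>Unitary diagonalizations of both matrices turn the congruence by \<open>S\<close> into
  one between sorted diagonal matrices, where \<open>sylvester_diag_le\<close> applies.
  \<open>S\<close> may be singular or rectangular, which explains the inequality.\<close>

lemma n_minus_congruence_le:
  assumes X: "X \<in> carrier_mat m m" "hermitian_mat X" and S: "S \<in> carrier_mat m k"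
  shows "n_minus (mat_adjoint S * X * S) \<le> n_minus X"
proof -
  obtain U ds where ds: "length ds = m" "sorted ds" "diagonalizes U (map complex_of_real ds) X"
    using hermitian_diagonalizes_sorted[OF X] by blast
  define Y where "Y = mat_adjoint S * X * S"
  have Y: "Y \<in> carrier_mat k k" "hermitian_mat Y"
    unfolding Y_def using X S adjoint_congruence_hermitian[OF X S] by (auto simp: mult_carrier_mat[of _ k m])
  obtain V es where es: "length es = k" "sorted es" "diagonalizes V (map complex_of_real es) Y"
    using hermitian_diagonalizes_sorted[OF Y] by blast
  let ?D = "diag_of_list (map complex_of_real ds)" and ?E = "diag_of_list (map complex_of_real es)"
  have D: "?D \<in> carrier_mat m m" using ds diag_of_list_carrier[of "map complex_of_real ds"] by simp
  have E: "?E \<in> carrier_mat k k" using es diag_of_list_carrier[of "map complex_of_real es"] by simp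
  have U: "U \<in> carrier_mat m m" "X = U * ?D * mat_adjoint U"
    using ds unfolding diagonalizes_def by auto
  have V: "V \<in> carrier_mat k k" "mat_adjoint V * V = 1\<^sub>m k" "Y = V * ?E * mat_adjoint V"
    using es unfolding diagonalizes_def by auto
  \<comment> \<open>\<open>T\<close> is \<open>S\<close> written in the eigenbases of
    \<open>X\<close> and \<open>Y\<close>, so that \<open>?E\<close> is the congruence of
    \<open>?D\<close> by \<open>T\<close>.\<close>
  define T where "T = mat_adjoint U * (S * V)"
  note [simp] = assoc_mult_mat[of _ k k _ k _ k] assoc_mult_mat[of _ m m _ m _ m]
     assoc_mult_mat[of _ k m _ m _ k] assoc_mult_mat[of _ k m _ m _ m]
     assoc_mult_mat[of _ m m _ m _ k]
     assoc_mult_mat[of _ k m _ k _ k] assoc_mult_mat[of _ m m _ k _ k]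
     assoc_mult_mat[of _ m k _ k _ k] assoc_mult_mat[of _ k k _ m _ m]
     assoc_mult_mat[of _ k k _ m _ k] 
     mult_carrier_mat[of _ k k _ k] mult_carrier_mat[of _ m m _ m] mult_carrier_mat[of _ k m _ m]
     mult_carrier_mat[of _ m m _ k] mult_carrier_mat[of _ m k _ k] mult_carrier_mat[of _ k m _ k]
     mult_carrier_mat[of _ k k _ m]
  have T: "T \<in> carrier_mat m k" unfolding T_def using U V S by simp
  have aT: "mat_adjoint T = mat_adjoint V * (mat_adjoint S * U)"
    unfolding T_def using U V S
    by (simp add: mat_adjoint_mult[of _ m m _ k] mat_adjoint_mult[of _ m k _ k])
  have "?E = (mat_adjoint V * V) * ?E * (mat_adjoint V * V)"
    unfolding V(2) using E by (simp add: left_mult_one_mat[of _ k k] right_mult_one_mat[of _ k k])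
  also have "\<dots> = mat_adjoint V * Y * V" unfolding V(3) using V(1) E by simp
  also have "\<dots> = mat_adjoint T * ?D * T"
    unfolding aT unfolding T_def Y_def U(2) using U(1) V(1) D S by simp
  finally have "length (filter (\<lambda>r. r < 0) es) \<le> length (filter (\<lambda>r. r < 0) ds)"
    using sylvester_diag_le[OF ds(2) es(2)] T ds es by simp
  then show ?thesis
    using n_minus_diagonalizes[OF ds(3)] n_minus_diagonalizes[OF es(3)] unfolding Y_def by simp
qed

section \<open>Pseudoinverse and range projector\<close>

text \<open>The product of \<open>X * Z\<close> and \<open>X * Y\<close> collapses to one factor or
  the other depending on the order, and taking adjoints exchanges the orders. Hence the two agree,
  likewise \<open>Y * X\<close> and \<open>Z * X\<close>, and then
  \<open>Y = Z * X * Y = Z\<close>.\<close>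

lemma is_pseudoinverse_unique:
  assumes X: "X \<in> carrier_mat m n" and Y: "is_pseudoinverse X Y" and Z: "is_pseudoinverse X Z"
  shows "Y = Z"
proof -
  have *: "X * Y = X * Z" "Y * X = Z * X" "Y * X * Y = Y" "Z * X * Z = Z"
    "Y \<in> carrier_mat n m" "Z \<in> carrier_mat n m"
    if Y: "is_pseudoinverse X Y" and Z: "is_pseudoinverse X Z" for Y Z
  proof -
    have c: "Y \<in> carrier_mat n m" "Z \<in> carrier_mat n m"
      and y: "X * Y * X = X" "Y * X * Y = Y" "mat_adjoint (X * Y) = X * Y" "mat_adjoint (Y * X) = Y * X"
      and z: "X * Z * X = X" "Z * X * Z = Z" "mat_adjoint (X * Z) = X * Z" "mat_adjoint (Z * X) = Z * X"
      using Y Z X unfolding is_pseudoinverse_def by auto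
    have c2: "X * Y \<in> carrier_mat m m" "X * Z \<in> carrier_mat m m"
      "Y * X \<in> carrier_mat n n" "Z * X \<in> carrier_mat n n" using c X by auto
    have "X * Y = (X * Z) * (X * Y)"
      using z(1) assoc_mult_mat[OF c2(2) X c(1)] by simp
    also have "\<dots> = mat_adjoint ((X * Y) * (X * Z))"
      using mat_adjoint_mult[OF c2(1) c2(2)] y z by simp
    also have "(X * Y) * (X * Z) = X * Z"
      using y(1) assoc_mult_mat[OF c2(1) X c(2)] by simp
    finally show "X * Y = X * Z" using z by simp
    have "Y * X = (Y * X) * (Z * X)"
      using z(1) assoc_mult_mat[OF c(1) X c2(4)] assoc_mult_mat[OF X c(2) X] by simp
    also have "\<dots> = mat_adjoint ((Z * X) * (Y * X))"
      using mat_adjoint_mult[OF c2(4) c2(3)] y z by simp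
    also have "(Z * X) * (Y * X) = Z * X"
      using y(1) assoc_mult_mat[OF c(2) X c2(3)] assoc_mult_mat[OF X c(1) X] by simp
    finally show "Y * X = Z * X" using z by simp
    show "Y * X * Y = Y" "Z * X * Z = Z" "Y \<in> carrier_mat n m" "Z \<in> carrier_mat n m" using y z c by auto
  qed
  note * = *[OF Y Z]
  have "Y = Z * X * Y" using * by simp
  also have "\<dots> = Z * (X * Y)" using X * by (simp add: assoc_mult_mat[of _ n m _ n _ m])
  also have "\<dots> = Z * X * Z" using X * by (simp add: assoc_mult_mat[of _ n m _ n _ m])
  finally show ?thesis using * by simp
qed

text \<open>Together with \<open>diagonalizes_adjoint\<close> and
  \<open>diagonalizes_unique\<close>, this reduces the Penrose conditions to identities between
  lists of eigenvalues.\<close>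

lemma diagonalizes_mult:
  assumes "diagonalizes U es A" "diagonalizes U fs B" "length fs = length es"
  shows "diagonalizes U (map2 (*) es fs) (A * B)"
proof -
  let ?n = "length es" and ?D = "diag_of_list es" and ?E = "diag_of_list fs" and ?V = "mat_adjoint U"
  have E: "?E \<in> carrier_mat ?n ?n" using diag_of_list_carrier[of fs] assms(3) by simp
  have U: "U \<in> carrier_mat ?n ?n" "?V * U = 1\<^sub>m ?n"
    and AB: "A = U * ?D * ?V" "B = U * ?E * ?V"
    using assms unfolding diagonalizes_def by auto
  note [simp] = assoc_mult_mat[of _ ?n ?n _ ?n _ ?n] mult_carrier_mat[of _ ?n ?n _ ?n]
    left_mult_one_mat[of _ ?n ?n] right_mult_one_mat[of _ ?n ?n]
  have "A * B = U * (?D * ((?V * U) * (?E * ?V)))" unfolding AB using U(1) E by simp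
  also have "\<dots> = U * diag_of_list (map2 (*) es fs) * ?V"
    unfolding U(2) diag_of_list_mult[OF assms(3)[symmetric], symmetric] using U(1) E by simp
  finally show ?thesis using assms unfolding diagonalizes_def by simp
qed

lemma diagonalizes_adjoint:
  assumes "diagonalizes U es A"
  shows "diagonalizes U (map cnj es) (mat_adjoint A)"
proof -
  let ?n = "length es" and ?D = "diag_of_list es" and ?V = "mat_adjoint U"
  have U: "U \<in> carrier_mat ?n ?n" and A: "A = U * ?D * ?V"
    using assms unfolding diagonalizes_def by auto
  have D: "mat_adjoint ?D = diag_of_list (map cnj es)" by (rule eq_matI) auto
  have "mat_adjoint A = U * (mat_adjoint ?D * ?V)"
    unfolding A using U by (simp add: mat_adjoint_mult[of _ ?n ?n _ ?n] mult_carrier_mat[of _ ?n ?n _ ?n])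
  also have "\<dots> = U * mat_adjoint ?D * ?V"
    using U by (simp add: assoc_mult_mat[of _ ?n ?n _ ?n _ ?n])
  finally show ?thesis using assms unfolding diagonalizes_def D by simp
qed

lemma diagonalizes_unique: "diagonalizes U es A \<Longrightarrow> diagonalizes U es B \<Longrightarrow> A = B"
  unfolding diagonalizes_def by simp

lemma hermitian_is_pseudoinverse_ex:
  assumes A: "A \<in> carrier_mat n n" "hermitian_mat A"
  shows "\<exists>Y. is_pseudoinverse A Y"
proof -
  obtain U rs where rs: "length rs = n" and d: "diagonalizes U (map complex_of_real rs) A"
    using hermitian_diagonalizes_sorted[OF A] by blast
  \<comment> \<open>\<open>inverse 0 = 0\<close> makes \<open>?is\<close> the list of eigenvalues of the pseudoinverse.\<close>
  let ?es = "map complex_of_real rs" and ?is = "map (\<lambda>r. complex_of_real (inverse r)) rs"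
  define Y where "Y = U * diag_of_list ?is * mat_adjoint U"
  have dY: "diagonalizes U ?is Y" using d unfolding diagonalizes_def Y_def by simp
  have Y: "Y \<in> carrier_mat n n"
    unfolding Y_def using d rs diag_of_list_carrier[of ?is] unfolding diagonalizes_def
    by (auto intro!: mult_carrier_mat[of _ n n])
  \<comment> \<open>These are the Penrose conditions for the scalars \<open>r\<close> and
    \<open>inverse r\<close>, including \<open>r = 0\<close>.\<close>
  have e: "map2 (*) (map2 (*) ?es ?is) ?es = ?es" "map2 (*) (map2 (*) ?is ?es) ?is = ?is"
    "map cnj (map2 (*) ?es ?is) = map2 (*) ?es ?is" "map cnj (map2 (*) ?is ?es) = map2 (*) ?is ?es"
    by (induction rs) (auto simp: field_simps)
  have p: "diagonalizes U (map2 (*) ?es ?is) (A * Y)" "diagonalizes U (map2 (*) ?is ?es) (Y * A)"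
    using diagonalizes_mult[OF d dY] diagonalizes_mult[OF dY d] by simp_all
  have "diagonalizes U (map2 (*) (map2 (*) ?es ?is) ?es) (A * Y * A)"
    by (rule diagonalizes_mult[OF p(1) d]) simp
  then have "A * Y * A = A" unfolding e using d by (rule diagonalizes_unique)
  moreover have "diagonalizes U (map2 (*) (map2 (*) ?is ?es) ?is) (Y * A * Y)"
    by (rule diagonalizes_mult[OF p(2) dY]) simp
  then have "Y * A * Y = Y" unfolding e using dY by (rule diagonalizes_unique)
  moreover have "mat_adjoint (A * Y) = A * Y" "mat_adjoint (Y * A) = Y * A"
    using diagonalizes_unique[OF diagonalizes_adjoint[OF p(1), unfolded e(3)] p(1)]
      diagonalizes_unique[OF diagonalizes_adjoint[OF p(2), unfolded e(4)] p(2)] by blast+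
  ultimately show ?thesis using A Y unfolding is_pseudoinverse_def by auto
qed

lemma is_pseudoinverse_pseudoinverse:
  assumes A: "A \<in> carrier_mat n n" "hermitian_mat A"
  shows "is_pseudoinverse A (pseudoinverse A)"
  unfolding pseudoinverse_def
  using hermitian_is_pseudoinverse_ex[OF A] is_pseudoinverse_unique[OF A(1)] by (metis theI)

lemma pseudoinverse_eqI:
  assumes "A \<in> carrier_mat m n" "is_pseudoinverse A Y"
  shows "pseudoinverse A = Y"
  unfolding pseudoinverse_def using is_pseudoinverse_unique[OF assms(1)] assms(2) by blast

text \<open>For Hermitian \<open>A\<close> the adjoint of \<open>Y\<close> satisfies the same
  Penrose conditions, so uniqueness makes \<open>Y\<close> Hermitian. Self-adjointness of
  \<open>A * Y\<close> then says that \<open>A\<close> and \<open>Y\<close> commute.\<close>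

lemma hermitian_pseudoinverse:
  assumes A: "A \<in> carrier_mat n n" "hermitian_mat A"
  defines "Y \<equiv> pseudoinverse A"
  shows "Y \<in> carrier_mat n n" "A * Y * A = A" "Y * A * Y = Y" "mat_adjoint (A * Y) = A * Y"
    "hermitian_mat Y" "Y * A = A * Y"
proof -
  have Y: "is_pseudoinverse A Y" unfolding Y_def by (rule is_pseudoinverse_pseudoinverse[OF A])
  then have y: "Y \<in> carrier_mat n n" "A * Y * A = A" "Y * A * Y = Y"
    "mat_adjoint (A * Y) = A * Y" "mat_adjoint (Y * A) = Y * A"
    using A unfolding is_pseudoinverse_def by auto
  then show "Y \<in> carrier_mat n n" "A * Y * A = A" "Y * A * Y = Y" "mat_adjoint (A * Y) = A * Y"
    by auto
  have hA: "mat_adjoint A = A" using A unfolding hermitian_mat_def by simp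
  note [simp] = assoc_mult_mat[of _ n n _ n _ n] mult_carrier_mat[of _ n n _ n]
    mat_adjoint_mult[of _ n n _ n]
  have a: "mat_adjoint Y * A = A * Y" "A * mat_adjoint Y = Y * A"
    using y(4,5) A(1) y(1) hA by simp_all
  have "is_pseudoinverse A (mat_adjoint Y)"
    unfolding is_pseudoinverse_def
  proof (intro conjI)
    show "mat_adjoint Y \<in> carrier_mat (dim_col A) (dim_row A)" using y(1) A by auto
    show "A * mat_adjoint Y * A = A"
      using arg_cong[OF y(2), of mat_adjoint] A(1) y(1) hA by simp
    show "mat_adjoint Y * A * mat_adjoint Y = mat_adjoint Y"
      using arg_cong[OF y(3), of mat_adjoint] A(1) y(1) hA by simp
    show "mat_adjoint (A * mat_adjoint Y) = A * mat_adjoint Y" unfolding a by (rule y(5))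
    show "mat_adjoint (mat_adjoint Y * A) = mat_adjoint Y * A" unfolding a by (rule y(4))
  qed
  then have "mat_adjoint Y = Y" using is_pseudoinverse_unique[OF A(1) _ Y] by blast
  then show "hermitian_mat Y" "Y * A = A * Y" using a unfolding hermitian_mat_def by auto
qed

lemma pseudoinverse_uminus:
  assumes A: "A \<in> carrier_mat n n" "hermitian_mat A"
  shows "pseudoinverse (- A) = - pseudoinverse A"
proof (rule pseudoinverse_eqI)
  let ?Y = "pseudoinverse A"
  show "- A \<in> carrier_mat n n" using A by simp
  note Y = is_pseudoinverse_pseudoinverse[OF A, unfolded is_pseudoinverse_def]
    hermitian_pseudoinverse(1)[OF A]
  note [simp] = uminus_mult_left_mat uminus_mult_right_mat mult_carrier_mat[of _ n n _ n]
  have "A * ?Y \<in> carrier_mat n n" "?Y * A \<in> carrier_mat n n" using A Y by auto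
  then show "is_pseudoinverse (- A) (- ?Y)"
    using A Y unfolding is_pseudoinverse_def by (auto simp: uminus_uminus_mat)
qed

text \<open>\<open>A * Y\<close> is an orthogonal projector with the range of \<open>A\<close>. Two
  such projectors fix each other's columns, and an adjoint shows that one and the same product
  equals both, so they coincide.\<close>

lemma range_projector_eq:
  assumes A: "A \<in> carrier_mat n n" "hermitian_mat A"
  shows "range_projector A = A * pseudoinverse A"
proof -
  define Y where "Y = pseudoinverse A"
  note y = hermitian_pseudoinverse[OF A, folded Y_def]
  note [simp] = assoc_mult_mat[of _ n n _ n _ n] mult_carrier_mat[of _ n n _ n]
  have mult_range: "mat_range (X * Z) \<subseteq> mat_range X"
    if XZ: "X \<in> carrier_mat n n" "Z \<in> carrier_mat n n" for X Z
  proof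
    fix x assume "x \<in> mat_range (X * Z)"
    then obtain v where "v \<in> carrier_vec (dim_col (X * Z))" and x: "x = (X * Z) *\<^sub>v v"
      unfolding mat_range_def by blast
    then have v: "v \<in> carrier_vec n" using carrier_matD(2)[OF XZ(2)] by simp
    have "x = X *\<^sub>v (Z *\<^sub>v v)" unfolding x by (rule assoc_mult_mat_vec[OF XZ v])
    moreover have "Z *\<^sub>v v \<in> carrier_vec (dim_col X)" using XZ v by simp
    ultimately show "x \<in> mat_range X" unfolding mat_range_def by blast
  qed
  \<comment> \<open>An idempotent fixes every vector of its range, in particular each column of
    \<open>X\<close>.\<close>
  have absorb: "P * X = X"
    if PX: "P \<in> carrier_mat n n" "P * P = P" "X \<in> carrier_mat n n" "mat_range X \<subseteq> mat_range P" for P X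
  proof (rule mat_col_eqI)
    fix i assume "i < dim_col X"
    then have i: "i < n" using PX by simp
    have "col X i = X *\<^sub>v unit_vec n i"
      using PX(3) i by (intro eq_vecI) (auto simp: scalar_prod_right_unit)
    then have "col X i \<in> mat_range X" using PX(3) unfolding mat_range_def by auto
    then have "col X i \<in> mat_range P" using PX(4) by blast
    then obtain v where v: "v \<in> carrier_vec n" "col X i = P *\<^sub>v v"
      using carrier_matD(2)[OF PX(1)] unfolding mat_range_def by blast
    have "P *\<^sub>v col X i = (P * P) *\<^sub>v v"
      unfolding v(2) by (rule assoc_mult_mat_vec[OF PX(1,1) v(1), symmetric])
    then have "P *\<^sub>v col X i = col X i" unfolding PX(2) v(2) .
    then show "col (P * X) i = col X i" using col_mult2[OF PX(1,3) i] by simp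
  qed (use PX in auto)
  have P: "is_range_projector A (A * Y)"
    unfolding is_range_projector_def
  proof (intro conjI)
    show "A * Y \<in> carrier_mat (dim_row A) (dim_row A)" using A y by auto
    have "A * Y * (A * Y) = (A * Y * A) * Y" using A y(1) by simp
    then show "A * Y * (A * Y) = A * Y" using y(2) by simp
    show "mat_adjoint (A * Y) = A * Y" by (rule y(4))
    have "mat_range A \<subseteq> mat_range (A * Y)"
      using mult_range[of "A * Y" A] A y(1,2) by simp
    then show "mat_range (A * Y) = mat_range A" using mult_range[OF A(1) y(1)] by simp
  qed
  have "Q = A * Y" if Q: "is_range_projector A Q" for Q
  proof -
    have q: "Q \<in> carrier_mat n n" "Q * Q = Q" "mat_adjoint Q = Q" "mat_range Q = mat_range A"
      using Q A unfolding is_range_projector_def by auto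
    have p: "A * Y \<in> carrier_mat n n" "A * Y * (A * Y) = A * Y" "mat_adjoint (A * Y) = A * Y"
      "mat_range (A * Y) = mat_range A"
      using P A unfolding is_range_projector_def by auto
    have "Q * (A * Y) = A * Y" by (rule absorb[OF q(1,2) p(1)]) (use p q in auto)
    moreover have "(A * Y) * Q = Q" by (rule absorb[OF p(1,2) q(1)]) (use p q in auto)
    then have "mat_adjoint Q * mat_adjoint (A * Y) = mat_adjoint Q"
      using mat_adjoint_mult[OF p(1) q(1)] by metis
    ultimately show ?thesis unfolding p(3) q(3) by simp
  qed
  then show ?thesis unfolding range_projector_def Y_def[symmetric] using P by blast
qed

section \<open>Block matrices and the index formula\<close>

text \<open>Two opposite inequalities suffice, so \<open>S\<close> and \<open>R\<close> need not be
  inverse to each other. This admits a singular matrix paired with its pseudoinverse.\<close>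

lemma n_minus_congruence_eq:
  assumes X: "X \<in> carrier_mat m m" "hermitian_mat X" and S: "S \<in> carrier_mat m k" and R: "R \<in> carrier_mat k m"
    and Y: "Y = mat_adjoint S * X * S" and X': "X = mat_adjoint R * Y * R"
  shows "n_minus Y = n_minus X"
proof -
  have "Y \<in> carrier_mat k k" "hermitian_mat Y"
    unfolding Y using X S adjoint_congruence_hermitian[OF X S] by (auto intro!: mult_carrier_mat[of _ k m])
  then have "n_minus X \<le> n_minus Y" using n_minus_congruence_le[of Y k R m] R X' by simp
  then show ?thesis using n_minus_congruence_le[OF X S] Y by simp
qed

text \<open>The characteristic polynomial is a product, so root orders add. The three sums range
  over different sets of eigenvalues and are first extended to the common set \<open>F\<close>,
  where a non-root contributes order zero.\<close>

lemma n_minus_four_block_diag: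
  assumes A: "A \<in> carrier_mat n n" and D: "D \<in> carrier_mat m m"
  shows "n_minus (four_block_mat A (0\<^sub>m n m) (0\<^sub>m m n) D) = n_minus A + n_minus D"
proof -
  let ?M = "four_block_mat A (0\<^sub>m n m) (0\<^sub>m m n) D"
  have M: "?M \<in> carrier_mat (n + m) (n + m)" using A D by simp
  have "n_minus X = (\<Sum>r \<in> F. order (complex_of_real r) (char_poly X))"
    if "X \<in> carrier_mat k k" "finite F" "F \<subseteq> {r. r < 0}"
      "{r. r < 0 \<and> eigenvalue X (complex_of_real r)} \<subseteq> F" for X k and F :: "real set"
    unfolding n_minus_def
  proof (rule sum.mono_neutral_left[OF that(2,4)], rule ballI)
    fix r assume "r \<in> F - {r. r < 0 \<and> eigenvalue X (complex_of_real r)}"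
    then have "\<not> eigenvalue X (complex_of_real r)" using that(3) by auto
    then show "order (complex_of_real r) (char_poly X) = 0"
      unfolding eigenvalue_root_char_poly[OF that(1)] by (rule order_0I)
  qed
  note nm = this
  have nz: "char_poly X \<noteq> 0" if "X \<in> carrier_mat k k" for X :: "complex mat" and k
    using degree_monic_char_poly[OF that] by auto
  define F where "F = {r :: real. r < 0 \<and> eigenvalue ?M (complex_of_real r)}"
  have F_neg: "F \<subseteq> {r. r < 0}" unfolding F_def by auto
  have "finite {z. poly (char_poly ?M) z = 0}" using nz[OF M] by (rule poly_roots_finite)
  then have "finite (complex_of_real -` {z. poly (char_poly ?M) z = 0})"
    by (rule finite_vimageI) (simp add: inj_on_def)
  then have F: "finite F"
    by (rule rev_finite_subset) (auto simp: F_def eigenvalue_root_char_poly[OF M])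
  have cp: "char_poly ?M = char_poly A * char_poly D" by (rule char_poly_four_block_diag[OF A D])
  have sub: "{r. r < 0 \<and> eigenvalue A (complex_of_real r)} \<subseteq> F"
    "{r. r < 0 \<and> eigenvalue D (complex_of_real r)} \<subseteq> F"
    unfolding F_def eigenvalue_root_char_poly[OF M] eigenvalue_root_char_poly[OF A]
      eigenvalue_root_char_poly[OF D] cp by auto
  have "n_minus ?M = (\<Sum>r \<in> F. order (complex_of_real r) (char_poly A) + order (complex_of_real r) (char_poly D))"
    unfolding n_minus_def F_def[symmetric] cp using nz[OF A] nz[OF D]
    by (intro sum.cong refl order_mult) simp
  also have "\<dots> = n_minus A + n_minus D"
    using nm[OF A F _ sub(1)] nm[OF D F _ sub(2)] by (simp add: sum.distrib F_neg)
  finally show ?thesis .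
qed

lemma four_block_congruence:
  fixes A :: "complex mat"
  assumes [simp]: "A \<in> carrier_mat n n" "D \<in> carrier_mat n n" "L \<in> carrier_mat n n"
  shows "mat_adjoint (four_block_mat (1\<^sub>m n) L (0\<^sub>m n n) (1\<^sub>m n)) * four_block_mat A (0\<^sub>m n n) (0\<^sub>m n n) D
      * four_block_mat (1\<^sub>m n) L (0\<^sub>m n n) (1\<^sub>m n) =
    four_block_mat A (A * L) (mat_adjoint L * A) (mat_adjoint L * A * L + D)"
proof -
  note [simp] = mult_four_block_mat[of _ n n _ n _ n _ _ n _ n] mult_carrier_mat[of _ n n _ n]
    left_mult_one_mat[of _ n n] right_mult_one_mat[of _ n n] left_add_zero_mat[of _ n n]
    right_add_zero_mat[of _ n n] left_mult_zero_mat[of _ n n] right_mult_zero_mat[of _ n n]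
  show ?thesis by (subst mat_adjoint_four_block[of _ n n _ n _ n]) simp_all
qed

lemma four_block_unitriangular_inverse:
  fixes L :: "complex mat"
  assumes [simp]: "L \<in> carrier_mat n n"
  shows "four_block_mat (1\<^sub>m n) L (0\<^sub>m n n) (1\<^sub>m n) * four_block_mat (1\<^sub>m n) (- L) (0\<^sub>m n n) (1\<^sub>m n) = 1\<^sub>m (n + n)"
proof -
  note [simp] = mult_four_block_mat[of _ n n _ n _ n _ _ n _ n] mult_carrier_mat[of _ n n _ n]
    left_mult_one_mat[of _ n n] right_mult_one_mat[of _ n n] left_add_zero_mat[of _ n n]
    right_add_zero_mat[of _ n n] left_mult_zero_mat[of _ n n] right_mult_zero_mat[of _ n n]
  show ?thesis by (simp add: uminus_l_inv_mat[of _ n n])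
qed

text \<open>Block elimination with the upper left block. The factor \<open>L\<close> takes the place
  of the inverse of \<open>A\<close> times the off-diagonal block, so \<open>A\<close> may be
  singular; \<open>D\<close> is the generalized Schur complement.\<close>

lemma n_minus_schur_complement:
  assumes A: "A \<in> carrier_mat n n" "hermitian_mat A" and D: "D \<in> carrier_mat n n" "hermitian_mat D"
    and L: "L \<in> carrier_mat n n"
  shows "n_minus (four_block_mat A (A * L) (mat_adjoint L * A) (mat_adjoint L * A * L + D)) = n_minus A + n_minus D"
proof -
  let ?X = "four_block_mat A (0\<^sub>m n n) (0\<^sub>m n n) D"
  let ?S = "four_block_mat (1\<^sub>m n) L (0\<^sub>m n n) (1\<^sub>m n)"
  let ?R = "four_block_mat (1\<^sub>m n) (- L) (0\<^sub>m n n) (1\<^sub>m n)"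
  let ?N = "n + n"
  have X: "?X \<in> carrier_mat ?N ?N" using A D by simp
  have S: "?S \<in> carrier_mat ?N ?N" and R: "?R \<in> carrier_mat ?N ?N"
    by (rule four_block_carrier_mat; simp)+
  have hX: "hermitian_mat ?X"
    using A D unfolding hermitian_mat_def by (subst mat_adjoint_four_block[of _ n n _ n _ n]) auto
  have SR: "?S * ?R = 1\<^sub>m ?N" by (rule four_block_unitriangular_inverse[OF L])
  define Y where "Y = mat_adjoint ?S * ?X * ?S"
  note [simp] = assoc_mult_mat[of _ ?N ?N _ ?N _ ?N] mult_carrier_mat[of _ ?N ?N _ ?N]
    left_mult_one_mat[of _ ?N ?N] right_mult_one_mat[of _ ?N ?N]
  have "mat_adjoint ?R * Y * ?R = (mat_adjoint ?R * mat_adjoint ?S) * ?X * (?S * ?R)"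
    unfolding Y_def using X S R by simp
  also have "mat_adjoint ?R * mat_adjoint ?S = 1\<^sub>m ?N"
    using arg_cong[OF SR, of mat_adjoint] mat_adjoint_mult[OF S R] by simp
  finally have "?X = mat_adjoint ?R * Y * ?R" unfolding SR using X by simp
  from n_minus_congruence_eq[OF X hX S R Y_def this]
  have "n_minus Y = n_minus A + n_minus D" using n_minus_four_block_diag[OF A(1) D(1)] by simp
  then show ?thesis unfolding Y_def using four_block_congruence[OF A(1) D(1) L] by simp
qed

text \<open>Congruence by the block permutation, which is its own adjoint and inverse. It makes
  elimination with the lower right block available too.\<close>

lemma n_minus_four_block_swap:
  assumes A: "A \<in> carrier_mat n n" "hermitian_mat A" and D: "D \<in> carrier_mat n n" "hermitian_mat D"
    and B: "B \<in> carrier_mat n n" 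
  shows "n_minus (four_block_mat D (mat_adjoint B) B A) = n_minus (four_block_mat A B (mat_adjoint B) D)"
proof -
  let ?N = "n + n"
  let ?X = "four_block_mat A B (mat_adjoint B) D"
  let ?Y = "four_block_mat D (mat_adjoint B) B A"
  let ?S = "four_block_mat (0\<^sub>m n n) (1\<^sub>m n) (1\<^sub>m n) (0\<^sub>m n n) :: complex mat"
  have X: "?X \<in> carrier_mat ?N ?N" using A D by simp
  have S: "?S \<in> carrier_mat ?N ?N" by (rule four_block_carrier_mat; simp)
  have hX: "hermitian_mat ?X"
    using A D B unfolding hermitian_mat_def by (subst mat_adjoint_four_block[of _ n n _ n _ n]) auto
  have aS: "mat_adjoint ?S = ?S" by (subst mat_adjoint_four_block[of _ n n _ n _ n]) auto
  note [simp] = mult_four_block_mat[of _ n n _ n _ n _ _ n _ n] mult_carrier_mat[of _ n n _ n]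
    left_mult_one_mat[of _ n n] right_mult_one_mat[of _ n n] left_add_zero_mat[of _ n n]
    right_add_zero_mat[of _ n n] left_mult_zero_mat[of _ n n] right_mult_zero_mat[of _ n n]
  show ?thesis
    by (rule n_minus_congruence_eq[OF X hX S S]) (use A B D aS in simp_all)
qed

text \<open>With \<open>Y\<close> the pseudoinverse, \<open>Y * A\<close> moves a vector
  \<open>u\<close> only by an element of the kernel of \<open>A\<close>, and \<open>B\<close>
  annihilates that difference.\<close>

lemma kernel_subset_factor:
  assumes A: "A \<in> carrier_mat n n" "hermitian_mat A" and B: "B \<in> carrier_mat n n"
    and ker: "mat_kernel A \<subseteq> mat_kernel B"
  shows "B * pseudoinverse A * A = B"
proof (rule mat_col_eqI)
  define Y where "Y = pseudoinverse A"
  note y = hermitian_pseudoinverse[OF A, folded Y_def]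
  fix i assume "i < dim_col B"
  then have i: "i < n" using B by simp
  define u :: "complex vec" where "u = unit_vec n i"
  have u: "u \<in> carrier_vec n" unfolding u_def by simp
  note [simp] = assoc_mult_mat_vec[of _ n n _ n] mult_mat_vec_carrier[of _ n n]
    mult_minus_distrib_mat_vec[of _ n n] mult_carrier_mat[of _ n n _ n]
  have "A *\<^sub>v (Y *\<^sub>v (A *\<^sub>v u)) = A *\<^sub>v u"
    using arg_cong[OF y(2), of "\<lambda>M. M *\<^sub>v u"] A u y(1) by simp
  then have "A *\<^sub>v (Y *\<^sub>v (A *\<^sub>v u) - u) = 0\<^sub>v n"
    using A u y(1) by simp
  then have "Y *\<^sub>v (A *\<^sub>v u) - u \<in> mat_kernel A"
    using A u y(1) by (intro mat_kernelI) auto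
  then have "B *\<^sub>v (Y *\<^sub>v (A *\<^sub>v u) - u) = 0\<^sub>v n"
    using ker mat_kernelD[OF B] by blast
  then have z: "B *\<^sub>v (Y *\<^sub>v (A *\<^sub>v u)) - B *\<^sub>v u = 0\<^sub>v n"
    using A B u y(1) by simp
  have "B *\<^sub>v (Y *\<^sub>v (A *\<^sub>v u)) = B *\<^sub>v u"
  proof (rule eq_vecI)
    fix j assume "j < dim_vec (B *\<^sub>v u)"
    then show "(B *\<^sub>v (Y *\<^sub>v (A *\<^sub>v u))) $ j = (B *\<^sub>v u) $ j"
      using arg_cong[OF z, of "\<lambda>v. v $ j"] B by (simp del: index_mult_mat_vec)
  qed (use B in simp)
  then have "(B * Y * A) *\<^sub>v u = B *\<^sub>v u" using A B u y(1) by simp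
  moreover have "col M i = M *\<^sub>v u" if "M \<in> carrier_mat n n" for M
    using that i unfolding u_def by (intro eq_vecI) (auto simp: scalar_prod_right_unit)
  ultimately show "col (B * pseudoinverse A * A) i = col B i"
    using A B y(1) unfolding Y_def[symmetric] by simp
qed (use A B in auto)

text \<open>Written with sums on both sides to avoid truncated subtraction of natural
  numbers.\<close>

lemma n_minus_diff_kernel_subset:
  assumes A: "A \<in> carrier_mat n n" "hermitian_mat A" and B: "B \<in> carrier_mat n n" "hermitian_mat B"
    and ker: "mat_kernel A \<subseteq> mat_kernel B"
  shows "n_minus (A - B) + n_minus B =
    n_minus A + n_minus (pseudoinverse B - range_projector B * pseudoinverse A * range_projector B)"
proof -
  define X where "X = pseudoinverse A"
  define Y where "Y = pseudoinverse B"
  note x = hermitian_pseudoinverse[OF A, folded X_def]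
  note y = hermitian_pseudoinverse[OF B, folded Y_def]
  have h: "mat_adjoint A = A" "mat_adjoint B = B" "mat_adjoint X = X" "mat_adjoint Y = Y"
    using A B x y unfolding hermitian_mat_def by auto
  have c [simp]: "A \<in> carrier_mat n n" "B \<in> carrier_mat n n" "X \<in> carrier_mat n n" "Y \<in> carrier_mat n n"
    using A B x y by auto
  note [simp] = assoc_mult_mat[of _ n n _ n _ n] mult_carrier_mat[of _ n n _ n]
    left_mult_one_mat[of _ n n] right_mult_one_mat[of _ n n]
    mult_minus_distrib_mat[of _ n n _ n] minus_mult_distrib_mat[of _ n n _ _ n]
    mat_adjoint_mult[of _ n n _ n] mat_adjoint_minus[of _ n n] minus_carrier_mat[of _ n n]
  note dims = carrier_matD[OF c(1)] carrier_matD[OF c(2)] carrier_matD[OF c(3)]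
  have BXA: "B * X * A = B" using kernel_subset_factor[OF A B(1) ker] unfolding X_def .
  have AXB: "A * (X * B) = B" using arg_cong[OF BXA, of mat_adjoint] h by simp
  let ?G = "B - B * X * B"
  have G: "?G \<in> carrier_mat n n" "hermitian_mat ?G"
    using h by (auto simp: hermitian_mat_def)
  have hAB: "A - B \<in> carrier_mat n n" "hermitian_mat (A - B)"
    using h by (auto simp: hermitian_mat_def)
  \<comment> \<open>Elimination with \<open>B\<close>, where the factor \<open>L\<close> is the
    identity.\<close>
  have "n_minus (four_block_mat B B B A) = n_minus B + n_minus (A - B)"
  proof -
    have "B + (A - B) = A" by (intro eq_matI) (auto simp: dims)
    then show ?thesis using n_minus_schur_complement[OF B hAB, of "1\<^sub>m n"] by simp
  qed
  \<comment> \<open>Elimination with \<open>A\<close> and the factor \<open>X * B\<close>; the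
    off-diagonal blocks are \<open>B\<close> by \<open>AXB\<close> and its adjoint.\<close>
  moreover have "n_minus (four_block_mat A B B B) = n_minus A + n_minus ?G"
  proof -
    have "mat_adjoint (X * B) * A = B" using BXA h by simp
    moreover have "B * (X * B) + ?G = B" by (intro eq_matI) (auto simp: dims)
    moreover have "B * X * A * (X * B) = B * (X * B)" unfolding BXA by simp
    ultimately show ?thesis using n_minus_schur_complement[OF A G, of "X * B"] AXB h by simp
  qed
  moreover have "n_minus (four_block_mat B B B A) = n_minus (four_block_mat A B B B)"
    using n_minus_four_block_swap[OF A B B(1)] h by simp
  \<comment> \<open>The two congruences are by \<open>Y\<close> and by \<open>B\<close>. They undo
    each other here because \<open>B\<close> and \<open>Y\<close> commute, so that
    \<open>B * B * Y = B\<close> as well.\<close>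
  moreover have "n_minus (Y - B * Y * X * (B * Y)) = n_minus ?G"
  proof (rule n_minus_congruence_eq[OF G, of Y n B])
    let ?P = "B * Y"
    have YB: "Y * B = B * Y" by (rule y(6))
    have YBY: "Y * (B * Y) = Y" and BYB: "B * (Y * B) = B" using y(2,3) by auto
    have "Y * (B * (X * (B * Y))) = (Y * B) * X * (B * Y)" by simp
    also have "\<dots> = B * Y * X * (B * Y)" unfolding YB ..
    finally show "Y - B * Y * X * (B * Y) = mat_adjoint Y * ?G * Y"
      unfolding h using YBY by simp
    have "B * (B * (Y * (X * (B * (Y * B))))) = B * (B * Y) * X * B" unfolding BYB by simp
    also have "B * (B * Y) = B" unfolding YB[symmetric] by (rule BYB)
    finally have "B * (B * (Y * (X * (B * (Y * B))))) = B * (X * B)" by simp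
    then show "?G = mat_adjoint B * (Y - B * Y * X * (B * Y)) * B"
      unfolding h using BYB by simp
  qed simp_all
  ultimately show ?thesis
    unfolding range_projector_eq[OF B] X_def[symmetric] Y_def[symmetric] by simp
qed

theorem proposition5p1:
  fixes A B :: "complex mat" and n :: nat
  assumes "A \<in> carrier_mat n n" and "B \<in> carrier_mat n n"
    and "hermitian_mat A" and "hermitian_mat B"
  shows "(mat_kernel A \<subseteq> mat_kernel B \<longrightarrow>
            int (n_minus (A - B)) =
              int (n_minus A) - int (n_minus B)
              + int (n_minus (pseudoinverse B
                  - range_projector B * pseudoinverse A * range_projector B)))
       \<and> (mat_kernel B \<subseteq> mat_kernel A \<longrightarrow>
            int (n_minus (A - B)) =
              int (n_minus A) - int (n_minus B)
              + int (n_minus (range_projector A * pseudoinverse B * range_projector A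
                  - pseudoinverse A))
              + int (n_zero A) - int (n_zero B))"
proof (intro conjI impI)
  note A = assms(1,3) and B = assms(2,4)
  {
    assume "mat_kernel A \<subseteq> mat_kernel B"
    from n_minus_diff_kernel_subset[OF A B this]
    show "int (n_minus (A - B)) = int (n_minus A) - int (n_minus B)
        + int (n_minus (pseudoinverse B - range_projector B * pseudoinverse A * range_projector B))"
      by linarith
  next
    assume ker: "mat_kernel B \<subseteq> mat_kernel A"
    \<comment> \<open>Negation preserves kernels and Hermitian matrices, so the pair
      \<open>- B\<close>, \<open>- A\<close> meets the hypotheses of the first part.\<close>
    have neg: "- X \<in> carrier_mat n n" "hermitian_mat (- X)" "mat_kernel (- X) = mat_kernel X"
      if "X \<in> carrier_mat n n" "hermitian_mat X" for X
      using that by (auto simp: hermitian_mat_def mat_kernel_def uminus_zero_vec_eq[of _ n])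
    note nA = neg[OF A] and nB = neg[OF B]
    have pA: "pseudoinverse A \<in> carrier_mat n n" and pB: "pseudoinverse B \<in> carrier_mat n n"
      using hermitian_pseudoinverse(1)[OF A] hermitian_pseudoinverse(1)[OF B] by auto
    let ?P = "range_projector A"
    have P: "?P \<in> carrier_mat n n" unfolding range_projector_eq[OF A] using A pA by auto
    have PA: "range_projector (- A) = ?P"
      unfolding range_projector_eq[OF A] range_projector_eq[OF nA(1,2)] pseudoinverse_uminus[OF A]
      using A pA by (simp add: uminus_uminus_mat)
    have "- B - - A = A - B" using A B by (intro eq_matI) auto
    moreover have "pseudoinverse (- A) - range_projector (- A) * pseudoinverse (- B) * range_projector (- A)
        = ?P * pseudoinverse B * ?P - pseudoinverse A"
      unfolding PA pseudoinverse_uminus[OF A] pseudoinverse_uminus[OF B] using P pA pB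
      by (intro eq_matI) auto
    ultimately have "n_minus (A - B) + n_minus (- A) =
        n_minus (- B) + n_minus (?P * pseudoinverse B * ?P - pseudoinverse A)"
      using n_minus_diff_kernel_subset[OF nB(1,2) nA(1,2)] ker nA(3) nB(3) by simp
    \<comment> \<open>The inertia count replaces \<open>n_minus (- A)\<close> by
      \<open>n - n_minus A - n_zero A\<close>, and likewise for \<open>B\<close>. The dimension
      \<open>n\<close> cancels and the kernel terms remain.\<close>
    then show "int (n_minus (A - B)) = int (n_minus A) - int (n_minus B)
        + int (n_minus (?P * pseudoinverse B * ?P - pseudoinverse A)) + int (n_zero A) - int (n_zero B)"
      using n_minus_add_n_plus_add_n_zero[OF A] n_minus_add_n_plus_add_n_zero[OF B] by linarith
  }
qed

end
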